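(* Let $k\in\mathbb N$ with $k\geq 2$, let $(p_1,\dots,p_{k-1})$ be a permutation of the set $\{\frac12,\frac1{2^2},\dots,\frac1{2^{k-1}}\}$, and let $P:=\sum_{j=1}^{k-1}p_j\delta_j+\sum_{j=k}^\infty\frac1{2^j}\delta_j$. Let $n\geq k+2$ and let $\{a_1,a_2,\dots,a_n\}$, with $a_1<a_2<\cdots<a_n$, be an optimal set of $n$-means for $P$. Suppose that $a_1=1,\ a_2=2,\ \dots,\ a_{n-3}=n-3$. Then either $$a_{n-2}=n-2,\quad a_{n-1}=Av[n-1,n],\quad a_n=Av[n+1,\infty),$$ or $$a_{n-2}=Av[n-2,n-1],\quad a_{n-1}=Av[n,n+1],\quad a_n=Av[n+2,\infty),$$ and the $n$th quantization error is $V_n(P)=\frac{2^{3-n}}{3}$.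
   Context: $\mathbb N=\{1,2,3,\dots\}$, and $\delta_x$ denotes the Dirac measure at $x\in\mathbb R$. For a Borel probability measure $P$ on $\mathbb R$ and a nonempty finite set $\alpha\subset\mathbb R$, the distortion error is $V(P;\alpha)=\int\min_{a\in\alpha}|x-a|^2\,dP(x)$. The $n$th quantization error is $V_n=V_n(P)=\inf\{V(P;\alpha):\alpha\subset\mathbb R,\ 1\le\mathrm{card}(\alpha)\le n\}$. An optimal set of $n$-means for $P$ is a set $\alpha$ with at most $n$ points for which this infimum is attained. For $P=\sum_{j\ge1}p_j\delta_j$ (where in the present setting $p_j=2^{-j}$ for $j\ge k$) and $i\le\ell$ in $\mathbb N$, write $Av[i,\ell]=\frac{\sum_{m=i}^{\ell}p_m m}{\sum_{m=i}^{\ell}p_m}$ and $Av[i,\infty)=\frac{\sum_{m=i}^{\infty}p_m m}{\sum_{m=i}^{\infty}p_m}$. *)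

theory Defs
  imports "HOL-Probability.Probability"
begin

text \<open>The Borel measure \<open>\<Sum>j\<ge>1. p j \<cdot> \<delta>\<^sub>j\<close> on the real line; the value \<open>p 0\<close> is not used.\<close>

definition dirac_series :: "(nat \<Rightarrow> real) \<Rightarrow> real measure" where
  "dirac_series p = measure_of UNIV (sets borel)
     (\<lambda>A. \<Sum>j. ennreal (p (Suc j)) * emeasure (return borel (real (Suc j))) A)"

lemma sets_dirac_series [simp, measurable_cong]: "sets (dirac_series p) = sets borel"
  unfolding dirac_series_def
  by (metis sets.sets_measure_of_eq space_borel)

lemma space_dirac_series [simp]: "space (dirac_series p) = UNIV"
  using sets_eq_imp_space_eq[OF sets_dirac_series] by simp

lemma emeasure_dirac_series:
  assumes "A \<in> sets borel"
  shows "emeasure (dirac_series p) A =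
    (\<Sum>j. ennreal (p (Suc j)) * emeasure (return borel (real (Suc j))) A)"
proof (rule emeasure_measure_of[OF dirac_series_def])
  show "sets borel \<subseteq> Pow (UNIV :: real set)" by simp
  show "A \<in> sets (dirac_series p)" using assms by simp
  show "positive (sets (dirac_series p))
     (\<lambda>A. \<Sum>j. ennreal (p (Suc j)) * emeasure (return borel (real (Suc j))) A)"
    by (simp add: positive_def)
  show "countably_additive (sets (dirac_series p))
     (\<lambda>A. \<Sum>j. ennreal (p (Suc j)) * emeasure (return borel (real (Suc j))) A)"
  proof (rule countably_additiveI)
    fix F :: "nat \<Rightarrow> real set"
    assume F: "range F \<subseteq> sets (dirac_series p)" "disjoint_family F"
    have "(\<Sum>i. \<Sum>j. ennreal (p (Suc j)) * emeasure (return borel (real (Suc j))) (F i)) =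
      (\<Sum>j. \<Sum>i. ennreal (p (Suc j)) * emeasure (return borel (real (Suc j))) (F i))"
      by (subst (1 3) nn_integral_count_space_nat[symmetric])
        (rule nn_integral_suminf, simp)
    also have "\<dots> = (\<Sum>j. ennreal (p (Suc j)) * emeasure (return borel (real (Suc j))) (\<Union>i. F i))"
      using F by (intro suminf_cong) (subst ennreal_suminf_cmult, subst suminf_emeasure, auto)
    finally show "(\<Sum>i. \<Sum>j. ennreal (p (Suc j)) * emeasure (return borel (real (Suc j))) (F i)) =
      (\<Sum>j. ennreal (p (Suc j)) * emeasure (return borel (real (Suc j))) (\<Union>i. F i))" .
  qed
qed

text \<open>The errors take values in \<open>[0, \<infinity>]\<close>, so that a measure without second moment has
  infinite distortion error (the Bochner integral would yield 0).\<close>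

definition distortion_error :: "real measure \<Rightarrow> real set \<Rightarrow> ennreal" where
  "distortion_error P \<alpha> = (\<integral>\<^sup>+ x. ennreal (Min ((\<lambda>a. \<bar>x - a\<bar>\<^sup>2) ` \<alpha>)) \<partial>P)"

definition quantization_error :: "real measure \<Rightarrow> nat \<Rightarrow> ennreal" where
  "quantization_error P n =
     (INF \<alpha>\<in>{\<alpha>. finite \<alpha> \<and> 1 \<le> card \<alpha> \<and> card \<alpha> \<le> n}. distortion_error P \<alpha>)"

definition optimal_means :: "real measure \<Rightarrow> nat \<Rightarrow> real set \<Rightarrow> bool" where
  "optimal_means P n \<alpha> \<longleftrightarrow>
     finite \<alpha> \<and> 1 \<le> card \<alpha> \<and> card \<alpha> \<le> n \<and> distortion_error P \<alpha> = quantization_error P n"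

definition Av :: "(nat \<Rightarrow> real) \<Rightarrow> nat \<Rightarrow> nat \<Rightarrow> real" where
  "Av p i l = (\<Sum>m=i..l. p m * real m) / (\<Sum>m=i..l. p m)"

definition Av_inf :: "(nat \<Rightarrow> real) \<Rightarrow> nat \<Rightarrow> real" where
  "Av_inf p i = (\<Sum>m. p (m + i) * real (m + i)) / (\<Sum>m. p (m + i))"

end

theory Submission
  imports Defs
begin

text \<open>Put \<open>b = n - 3\<close>. The points \<open>1, \<dots>, b\<close> carry no error, and beyond \<open>b\<close> the masses are
  exactly dyadic, so after translating by \<open>b\<close> and dividing by \<open>2\<^sup>-\<^sup>b\<close> the problem is to place
  \<open>0 < x < y < z\<close>, in addition to \<open>0\<close>, for the masses \<open>2\<^sup>-\<^sup>j\<close> at \<open>j \<ge> 1\<close>. The Voronoi cells are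
  intervals of integers. For each position of the cell boundaries, completing the square bounds
  the error from below; only the cells \<open>{1}, {2,3}, {4,\<dots>}\<close> and \<open>{1,2}, {3,4}, {5,\<dots>}\<close> reach \<open>1/3\<close>,
  all others exceed it. Since the first configuration is admissible, its error bounds \<open>V\<^sub>n\<close> from
  above, which forces the given optimal set into one of the two.\<close>

section \<open>Integration against a series of point masses\<close>

text \<open>As a pushforward of a weighted counting measure, the series is open to the
  change-of-variables rules that turn distortion errors into sums.\<close>

lemma dirac_series_eq_distr:
  "dirac_series p =
    distr (density (count_space UNIV) (\<lambda>j. ennreal (p (Suc j)))) borel (\<lambda>j. real (Suc j))"
proof (rule measure_eqI)
  fix A assume "A \<in> sets (dirac_series p)"
  then have A: "A \<in> sets borel" by simp
  then show "emeasure (dirac_series p) A = emeasure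
      (distr (density (count_space UNIV) (\<lambda>j. ennreal (p (Suc j)))) borel (\<lambda>j. real (Suc j))) A"
    by (subst emeasure_distr)
      (auto simp: emeasure_dirac_series emeasure_density nn_integral_count_space_nat
        indicator_def intro!: suminf_cong)
qed simp

lemma nn_integral_dirac_series:
  assumes [measurable]: "f \<in> borel_measurable borel"
  shows "(\<integral>\<^sup>+ x. f x \<partial>dirac_series p) = (\<Sum>j. ennreal (p (Suc j)) * f (real (Suc j)))"
  unfolding dirac_series_eq_distr
  by (simp add: nn_integral_distr nn_integral_density nn_integral_count_space_nat)

lemma distortion_error_dirac_series:
  assumes "finite \<alpha>"
  shows "distortion_error (dirac_series p) \<alpha> =
    (\<Sum>j. ennreal (p (Suc j)) * ennreal (Min ((\<lambda>a. \<bar>real (Suc j) - a\<bar>\<^sup>2) ` \<alpha>)))"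
proof -
  have "(\<lambda>x. Min ((\<lambda>a. \<bar>x - a\<bar>\<^sup>2) ` \<alpha>)) \<in> borel_measurable borel"
    by (rule borel_measurable_Min) (use assms in auto)
  then have "(\<lambda>x. ennreal (Min ((\<lambda>a. \<bar>x - a\<bar>\<^sup>2) ` \<alpha>))) \<in> borel_measurable borel"
    by simp
  then show ?thesis
    unfolding distortion_error_def by (rule nn_integral_dirac_series)
qed

section \<open>Dyadic tails and conditional means\<close>

text \<open>Normalised, the masses from \<open>s\<close> on form a geometric law with mean
  \<open>s + 1\<close> and variance 2; their total is \<open>2 * (1/2) ^ s\<close>. The proof
  telescopes: \<open>?T i - ?T (Suc i)\<close> is the \<open>i\<close>th summand.\<close>

lemma dyadic_square_tail_sums:
  "(\<lambda>i. (1/2) ^ (i + s) * (real (i + s) - z)\<^sup>2) sums (2 * (1/2) ^ s * (2 + (real s + 1 - z)\<^sup>2))"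
proof -
  let ?T = "\<lambda>i. 2 * (1/2) ^ (i + s) * (2 + (real (i + s) + 1 - z)\<^sup>2)"
  have "?T \<longlonglongrightarrow> 0" by real_asymp
  from telescope_sums'[OF this] show ?thesis
    by (simp add: power2_eq_square algebra_simps)
qed

lemma dyadic_linear_tail_sums:
  "(\<lambda>i. (1/2) ^ (i + s) * real (i + s)) sums (2 * (1/2) ^ s * (real s + 1))"
proof -
  let ?T = "\<lambda>i. 2 * (1/2) ^ (i + s) * (real (i + s) + 1)"
  have "?T \<longlonglongrightarrow> 0" by real_asymp
  from telescope_sums'[OF this] show ?thesis
    by (simp add: algebra_simps)
qed

lemma dyadic_tail_sums: "(\<lambda>i. (1/2) ^ (i + s)) sums (2 * (1/2) ^ s :: real)"
  using sums_mult[OF power_half_series, of "2 * (1/2) ^ s"] by (simp add: power_add mult_ac)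

lemma Av_inf_dyadic:
  assumes "\<And>j. j \<ge> s \<Longrightarrow> p j = 1 / 2 ^ j"
  shows "Av_inf p s = real s + 1"
proof -
  have p: "p (m + s) = (1/2) ^ (m + s)" for m
    using assms by (simp add: power_one_over)
  show ?thesis
    unfolding Av_inf_def p sums_unique[OF dyadic_linear_tail_sums, symmetric]
      sums_unique[OF dyadic_tail_sums, symmetric] by simp
qed

text \<open>The two masses are in ratio 2:1, so the mean lies a third of the way along.\<close>

lemma Av_dyadic_pair:
  assumes "\<And>j. j \<ge> s \<Longrightarrow> p j = 1 / 2 ^ j"
  shows "Av p s (Suc s) = real s + 1/3"
  by (simp add: Av_def assms field_simps)

section \<open>Reduction to three free points\<close>

text \<open>The origin is the translate of \<open>b\<close>, the last fixed point.\<close>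

definition cost :: "real \<Rightarrow> real \<Rightarrow> real \<Rightarrow> nat \<Rightarrow> real" where
  "cost x y z i = min ((real i)\<^sup>2) (min ((real i - x)\<^sup>2) (min ((real i - y)\<^sup>2) ((real i - z)\<^sup>2)))"

definition tail_error :: "real \<Rightarrow> real \<Rightarrow> real \<Rightarrow> real" where
  "tail_error x y z = (\<Sum>i. (1/2) ^ Suc i * cost x y z (Suc i))"

lemma cost_nonneg: "0 \<le> cost x y z i"
  by (simp add: cost_def)

lemma cost_le: "cost x y z i \<le> (real i)\<^sup>2" "cost x y z i \<le> (real i - x)\<^sup>2"
  "cost x y z i \<le> (real i - y)\<^sup>2" "cost x y z i \<le> (real i - z)\<^sup>2"
  by (simp_all add: cost_def)

lemma summable_cost: "summable (\<lambda>i. (1/2) ^ Suc i * cost x y z (Suc i))"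
proof (rule summable_comparison_test')
  show "summable (\<lambda>i. (1/2) ^ Suc i * (real (Suc i) - z)\<^sup>2)"
    using sums_summable[OF dyadic_square_tail_sums[of 1 z]] by simp
  show "norm ((1/2) ^ Suc i * cost x y z (Suc i)) \<le> (1/2) ^ Suc i * (real (Suc i) - z)\<^sup>2" for i
    using cost_le(4)[of x y z "Suc i"] cost_nonneg[of x y z "Suc i"]
    by (simp add: abs_mult del: of_nat_Suc)
qed

text \<open>Seen from an atom to the right of \<open>b\<close>, the points
  \<open>1, ..., b - 1\<close> are farther away than \<open>b\<close> and drop out of the
  minimum.\<close>

lemma Min_square_dist_eq_cost:
  assumes "b \<ge> 1" "i \<ge> 1"
  shows "Min ((\<lambda>a. \<bar>real (b + i) - a\<bar>\<^sup>2) ` (real ` {1..b} \<union> {b + x, b + y, b + z})) = cost x y z i"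
proof (rule Min_eqI)
  show "finite ((\<lambda>a. \<bar>real (b + i) - a\<bar>\<^sup>2) ` (real ` {1..b} \<union> {b + x, b + y, b + z}))" by simp
next
  fix u assume "u \<in> (\<lambda>a. \<bar>real (b + i) - a\<bar>\<^sup>2) ` (real ` {1..b} \<union> {b + x, b + y, b + z})"
  then consider j where "j \<in> {1..b}" "u = (real (b + i) - real j)\<^sup>2"
    | "u = (real i - x)\<^sup>2" | "u = (real i - y)\<^sup>2" | "u = (real i - z)\<^sup>2"
    by (auto simp: add_diff_eq)
  then show "cost x y z i \<le> u"
  proof cases
    case 1
    then have "(real i)\<^sup>2 \<le> u" by (auto intro!: power_mono)
    then show ?thesis using cost_le(1)[of x y z i] by linarith
  qed (auto simp: cost_le)
next
  have "cost x y z i \<in> {(real i)\<^sup>2, (real i - x)\<^sup>2, (real i - y)\<^sup>2, (real i - z)\<^sup>2}"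
    by (auto simp: cost_def min_def)
  also have "\<dots> = (\<lambda>a. \<bar>real (b + i) - a\<bar>\<^sup>2) ` {real b, b + x, b + y, b + z}"
    by simp
  also have "\<dots> \<subseteq> (\<lambda>a. \<bar>real (b + i) - a\<bar>\<^sup>2) ` (real ` {1..b} \<union> {b + x, b + y, b + z})"
    using assms by (intro image_mono) auto
  finally show "cost x y z i \<in> (\<lambda>a. \<bar>real (b + i) - a\<bar>\<^sup>2) ` (real ` {1..b} \<union> {b + x, b + y, b + z})" .
qed

text \<open>The atoms at \<open>1, ..., b\<close> are code points and cost nothing, whatever their
  masses; the later masses are \<open>(1/2) ^ b\<close> times those of the reduced problem.\<close>

lemma distortion_error_eq_tail_error:
  assumes b: "b \<ge> 1" and p: "\<And>j. j > b \<Longrightarrow> p j = 1 / 2 ^ j"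
  shows "distortion_error (dirac_series p) (real ` {1..b} \<union> {b + x, b + y, b + z}) =
    ennreal ((1/2) ^ b * tail_error x y z)"
proof -
  let ?\<alpha> = "real ` {1..b} \<union> {b + x, b + y, b + z}"
  let ?M = "\<lambda>j. Min ((\<lambda>a. \<bar>real j - a\<bar>\<^sup>2) ` ?\<alpha>)"
  \<comment> \<open>Index \<open>j\<close> stands for the atom \<open>Suc j\<close>, so
    \<open>j < b\<close> selects exactly the atoms at \<open>1, ..., b\<close>.\<close>
  define f where "f j = (if j < b then 0 else (1/2) ^ Suc j * ?M (Suc j))" for j
  have f_shift: "f (i + b) = (1/2) ^ b * ((1/2) ^ Suc i * cost x y z (Suc i))" for i
    using Min_square_dist_eq_cost[OF b, of "Suc i" x y z]
    by (simp add: f_def power_add add.commute)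
  have f_nonneg: "0 \<le> f j" for j
  proof (cases "j < b")
    case False
    then show ?thesis
      using f_shift[of "j - b"] cost_nonneg[of x y z "Suc (j - b)"]
      by (simp del: power_Suc)
  qed (simp add: f_def)
  have "summable (\<lambda>i. f (i + b))"
    unfolding f_shift by (intro summable_mult summable_cost)
  then have summable_f: "summable f" by (rule summable_iff_shift[THEN iffD1])
  have "ennreal (p (Suc j)) * ennreal (?M (Suc j)) = ennreal (f j)" for j
  proof (cases "j < b")
    case True
    have "?M (Suc j) = 0"
    proof (rule Min_eqI)
      show "0 \<in> (\<lambda>a. \<bar>real (Suc j) - a\<bar>\<^sup>2) ` ?\<alpha>"
        using True by (intro image_eqI[of _ _ "real (Suc j)"] UnI1 imageI) auto
    qed auto
    then show ?thesis using True by (simp add: f_def)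
  next
    case False
    then show ?thesis
      by (simp add: f_def p ennreal_mult'[symmetric] power_one_over)
  qed
  then have "distortion_error (dirac_series p) ?\<alpha> = (\<Sum>j. ennreal (f j))"
    by (subst distortion_error_dirac_series) auto
  also have "\<dots> = ennreal (suminf f)"
    using f_nonneg summable_f by (rule suminf_ennreal2)
  also have "suminf f = (\<Sum>i. f (i + b))"
    using suminf_split_initial_segment[OF summable_f, of b] by (simp add: f_def)
  also have "\<dots> = (1/2) ^ b * tail_error x y z"
    unfolding f_shift tail_error_def by (rule suminf_mult) (rule summable_cost)
  finally show ?thesis .
qed

lemma tail_error_ge_partial: "(\<Sum>i<s. (1/2) ^ Suc i * cost x y z (Suc i)) \<le> tail_error x y z"
  unfolding tail_error_def
  by (rule sum_le_suminf[OF summable_cost]) (auto simp: cost_nonneg)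

lemma tail_error_split:
  "tail_error x y z = (\<Sum>i<s. (1/2) ^ Suc i * cost x y z (Suc i)) +
    (\<Sum>i. (1/2) ^ (i + Suc s) * cost x y z (i + Suc s))"
  unfolding tail_error_def using suminf_split_initial_segment[OF summable_cost, of x y z s]
  by simp

text \<open>The atoms beyond \<open>s\<close> have total mass \<open>(1/2) ^ s\<close>, mean
  \<open>s + 2\<close> and variance 2.\<close>

lemma tail_error_eq:
  assumes "\<And>i. i > s \<Longrightarrow> cost x y z i = (real i - z)\<^sup>2"
  shows "tail_error x y z = (\<Sum>i<s. (1/2) ^ Suc i * cost x y z (Suc i)) +
    (1/2) ^ s * (2 + (real s + 2 - z)\<^sup>2)"
proof -
  have "(\<Sum>i. (1/2) ^ (i + Suc s) * cost x y z (i + Suc s)) =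
      (\<Sum>i. (1/2) ^ (i + Suc s) * (real (i + Suc s) - z)\<^sup>2)"
    using assms by (intro suminf_cong) simp
  also have "\<dots> = (1/2) ^ s * (2 + (real s + 2 - z)\<^sup>2)"
    using sums_unique[OF dyadic_square_tail_sums[of "Suc s" z]] by (simp add: add.commute)
  finally show ?thesis by (simp only: tail_error_split[of x y z s])
qed

section \<open>Voronoi cells and the lower bound\<close>

lemma square_dist_le_iff:
  fixes u v i :: real
  assumes "u < v"
  shows "(i - v)\<^sup>2 \<le> (i - u)\<^sup>2 \<longleftrightarrow> u + v \<le> 2 * i"
proof -
  have "(i - u)\<^sup>2 - (i - v)\<^sup>2 = (v - u) * (2 * i - (u + v))"
    by (simp add: power2_eq_square algebra_simps)
  then show ?thesis using assms by (smt (verit) mult_nonneg_nonneg mult_pos_neg)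
qed

text \<open>Cell boundaries are midpoints of neighbours, so testing from the right finds a nearest
  point; at a tie both costs agree.\<close>

lemma cost_cells:
  assumes "0 < x" "x < y" "y < z"
  shows "cost x y z i =
    (if y + z \<le> 2 * real i then (real i - z)\<^sup>2 else if x + y \<le> 2 * real i then (real i - y)\<^sup>2
     else if x \<le> 2 * real i then (real i - x)\<^sup>2 else (real i)\<^sup>2)"
  using assms square_dist_le_iff[of y z "real i"] square_dist_le_iff[of x y "real i"]
    square_dist_le_iff[of 0 x "real i"]
  by (auto simp: cost_def min_def)

lemma tail_error_le_third:
  assumes xyz: "0 < x" "x < y" "y < z" and le: "tail_error x y z \<le> 1/3"
  shows "(x = 1 \<and> y = 7/3 \<and> z = 5 \<or> x = 4/3 \<and> y = 10/3 \<and> z = 6) \<and> tail_error x y z = 1/3"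
proof -
  note cells = cost_cells[OF xyz]
  let ?c = "cost x y z"
  let ?T = "tail_error x y z"
  have full: "?T = (\<Sum>i<s. (1/2) ^ Suc i * ?c (Suc i)) + (1/2) ^ s * (2 + (real s + 2 - z)\<^sup>2)"
    if "y + z \<le> 2 * (real s + 1)" for s
    by (rule tail_error_eq) (use that in \<open>auto simp: cells\<close>)
  have full2: "?T = ?c 1 / 2 + ?c 2 / 4 + 1/2 + (4 - z)\<^sup>2 / 4" if "y + z \<le> 6"
    using full[of 2] that by (simp add: eval_nat_numeral add_divide_distrib)
  have full3: "?T = ?c 1 / 2 + ?c 2 / 4 + ?c 3 / 8 + 1/4 + (5 - z)\<^sup>2 / 8" if "y + z \<le> 8"
    using full[of 3] that by (simp add: eval_nat_numeral add_divide_distrib)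
  have full4: "?T = ?c 1 / 2 + ?c 2 / 4 + ?c 3 / 8 + ?c 4 / 16 + 1/8 + (6 - z)\<^sup>2 / 16"
    if "y + z \<le> 10"
    using full[of 4] that by (simp add: eval_nat_numeral add_divide_distrib)
  have full5: "?T = ?c 1 / 2 + ?c 2 / 4 + ?c 3 / 8 + ?c 4 / 16 + ?c 5 / 32 + 1/16 + (7 - z)\<^sup>2 / 32"
    if "y + z \<le> 12"
    using full[of 5] that by (simp add: eval_nat_numeral add_divide_distrib)
  \<comment> \<open>This bound serves the cases in which the cell of \<open>z\<close> starts too far
    out for its exact position to matter.\<close>
  have part6: "?c 1 / 2 + ?c 2 / 4 + ?c 3 / 8 + ?c 4 / 16 + ?c 5 / 32 + ?c 6 / 64 \<le> ?T"
    using tail_error_ge_partial[where s = 6, of x y z]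
    by (simp add: eval_nat_numeral)
  have nonneg: "0 \<le> ?c 1" "0 \<le> ?c 2" "0 \<le> ?c 3" "0 \<le> ?c 4" "0 \<le> ?c 5" "0 \<le> ?c 6"
    by (rule cost_nonneg)+
  \<comment> \<open>Otherwise \<open>z\<close> serves all atoms from 3 on, and their variance alone
    costs 1/2.\<close>
  have gap: "6 < y + z"
  proof (rule ccontr)
    assume "\<not> 6 < y + z"
    then have "?T = ?c 1 / 2 + ?c 2 / 4 + 1/2 + (4 - z)\<^sup>2 / 4" by (intro full2) simp
    then show False using le nonneg zero_le_power2[of "4 - z"] by linarith
  qed
  \<comment> \<open>Otherwise atom 1 is served from 0 at cost 1/2.\<close>
  have "x \<le> 2"
  proof (rule ccontr)
    assume "\<not> x \<le> 2"
    then have "?c 1 = 1" using xyz by (simp add: cells)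
    then show False using part6 nonneg le by linarith
  qed
  \<comment> \<open>A single point \<open>w\<close> for the atoms 1, 2, 3 costs at least 13/28 >
    1/3; their weighted mean is 11/7. This keeps both \<open>x\<close> and \<open>y\<close> from
    serving all three.\<close>
  have three: "(1 - w)\<^sup>2 / 2 + (2 - w)\<^sup>2 / 4 + (3 - w)\<^sup>2 / 8 = 7/8 * (w - 11/7)\<^sup>2 + 13/28" for w :: real
    by (simp add: power2_eq_square field_simps)
  have not_three: False if "?c 1 = (1 - w)\<^sup>2" "?c 2 = (2 - w)\<^sup>2" "?c 3 = (3 - w)\<^sup>2" for w
    using three[of w] part6 nonneg le zero_le_power2[of "w - 11/7"] unfolding that by linarith
  have "x + y \<le> 6"
  proof (rule ccontr)
    assume "\<not> x + y \<le> 6"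
    then show False using gap \<open>x \<le> 2\<close> by (intro not_three[of x]) (simp_all add: cells)
  qed
  then have c3: "?c 3 = (3 - y)\<^sup>2" using gap by (simp add: cells)
  have "\<not> x + y \<le> 2"
  proof
    assume "x + y \<le> 2"
    then show False using gap by (intro not_three[of y]) (simp_all add: cells)
  qed
  then have c1: "?c 1 = (1 - x)\<^sup>2" using gap \<open>x \<le> 2\<close> by (simp add: cells)
  have c4: "?c 4 = (4 - y)\<^sup>2" if "8 < y + z"
    using that \<open>x + y \<le> 6\<close> by (simp add: cells)
  have c5: "?c 5 = (5 - y)\<^sup>2" if "10 < y + z"
    using that \<open>x + y \<le> 6\<close> by (simp add: cells)
  have c6: "?c 6 = (6 - y)\<^sup>2" if "12 < y + z"
    using that \<open>x + y \<le> 6\<close> by (simp add: cells)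
  show ?thesis
  \<comment> \<open>Atom 1 now belongs to \<open>x\<close> and atom 3 to \<open>y\<close>. It
    remains to see which of them serves atom 2, and where the cell of \<open>y\<close> ends.\<close>
  proof (cases "x + y \<le> 4")
    case True
    then have c2: "?c 2 = (2 - y)\<^sup>2" using gap by (simp add: cells)
    consider "y + z \<le> 8" | "8 < y + z" "y + z \<le> 10" | "10 < y + z" by linarith
    then show ?thesis
    proof cases
      case 1
      \<comment> \<open>Cells \<open>{1}\<close>, \<open>{2,3}\<close>, \<open>{4,...}\<close>: the
        squares are centred at the cell means, so the bound 1/3 forces each to vanish.\<close>
      have "?T = 1/3 + (x - 1)\<^sup>2 / 2 + 3/8 * (y - 7/3)\<^sup>2 + (z - 5)\<^sup>2 / 8"
        unfolding full3[OF 1] c1 c2 c3 by (simp add: power2_eq_square field_simps)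
      moreover from this have "(x - 1)\<^sup>2 = 0" "(y - 7/3)\<^sup>2 = 0" "(z - 5)\<^sup>2 = 0"
        using le zero_le_power2[of "x - 1"] zero_le_power2[of "y - 7/3"] zero_le_power2[of "z - 5"]
        by linarith+
      ultimately show ?thesis by simp
    next
      case 2
      \<comment> \<open>Cells \<open>{1}\<close>, \<open>{2,3,4}\<close>, \<open>{5,...}\<close>:
        already 5/14 > 1/3.\<close>
      have "?T = 5/14 + (x - 1)\<^sup>2 / 2 + 7/16 * (y - 18/7)\<^sup>2 + (z - 6)\<^sup>2 / 16"
        unfolding full4[OF 2(2)] c1 c2 c3 c4[OF 2(1)] by (simp add: power2_eq_square field_simps)
      then show ?thesis
        using le zero_le_power2[of "x - 1"] zero_le_power2[of "y - 18/7"] zero_le_power2[of "z - 6"]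
        by linarith
    next
      case 3
      have c4': "?c 4 = (4 - y)\<^sup>2" using 3 by (intro c4) simp
      \<comment> \<open>The atoms 2 to 5 all go to \<open>y\<close>, with mean 41/15 and error at
        least 97/240 > 1/3.\<close>
      have "?c 2 / 4 + ?c 3 / 8 + ?c 4 / 16 + ?c 5 / 32 = 97/240 + 15/32 * (y - 41/15)\<^sup>2"
        unfolding c2 c3 c4' c5[OF 3] by (simp add: power2_eq_square field_simps)
      then show ?thesis
        using part6 le nonneg zero_le_power2[of "y - 41/15"] by linarith
    qed
  next
    case False
    then have c2: "?c 2 = (2 - x)\<^sup>2" using gap \<open>x \<le> 2\<close> by (simp add: cells)
    have c12: "?c 1 / 2 + ?c 2 / 4 = 1/6 + 3/4 * (x - 4/3)\<^sup>2"
      unfolding c1 c2 by (simp add: power2_eq_square field_simps)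
    consider "y + z \<le> 8" | "8 < y + z" "y + z \<le> 10" | "10 < y + z" "y + z \<le> 12" | "12 < y + z"
      by linarith
    then show ?thesis
    proof cases
      case 1
      \<comment> \<open>Cells \<open>{1,2}\<close>, \<open>{3}\<close>, \<open>{4,...}\<close>: at
        least 1/6 + 1/4.\<close>
      show ?thesis
        using full3[OF 1] c12 le nonneg zero_le_power2[of "x - 4/3"] zero_le_power2[of "5 - z"]
        by linarith
    next
      case 2
      \<comment> \<open>Cells \<open>{1,2}\<close>, \<open>{3,4}\<close>, \<open>{5,...}\<close>:
        the minima 1/6, 1/24 and 1/8 add up to exactly 1/3.\<close>
      have "?c 3 / 8 + ?c 4 / 16 = 1/24 + 3/16 * (y - 10/3)\<^sup>2"
        unfolding c3 c4[OF 2(1)] by (simp add: power2_eq_square field_simps)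
      then have "?T = 1/3 + 3/4 * (x - 4/3)\<^sup>2 + 3/16 * (y - 10/3)\<^sup>2 + (6 - z)\<^sup>2 / 16"
        using full4[OF 2(2)] c12 by linarith
      moreover from this have "(x - 4/3)\<^sup>2 = 0" "(y - 10/3)\<^sup>2 = 0" "(6 - z)\<^sup>2 = 0"
        using le zero_le_power2[of "x - 4/3"] zero_le_power2[of "y - 10/3"] zero_le_power2[of "6 - z"]
        by linarith+
      ultimately show ?thesis by simp
    next
      case 3
      have c4': "?c 4 = (4 - y)\<^sup>2" using 3 by (intro c4) simp
      \<comment> \<open>Cells \<open>{1,2}\<close>, \<open>{3,4,5}\<close>, \<open>{6,...}\<close>:
        1/6 + 13/112 + 1/16 exceeds 1/3.\<close>
      have "?c 3 / 8 + ?c 4 / 16 + ?c 5 / 32 = 13/112 + 7/32 * (y - 25/7)\<^sup>2"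
        unfolding c3 c4' c5[OF 3(1)] by (simp add: power2_eq_square field_simps)
      then show ?thesis
        using full5[OF 3(2)] c12 le zero_le_power2[of "x - 4/3"] zero_le_power2[of "y - 25/7"]
          zero_le_power2[of "7 - z"]
        by linarith
    next
      case 4
      have c45: "?c 4 = (4 - y)\<^sup>2" "?c 5 = (5 - y)\<^sup>2" using 4 by (auto intro!: c4 c5)
      \<comment> \<open>The atoms 3 to 6 all go to \<open>y\<close>; with the pair 1, 2 this costs
        at least 1/6 + 97/480 > 1/3.\<close>
      have "?c 3 / 8 + ?c 4 / 16 + ?c 5 / 32 + ?c 6 / 64 = 97/480 + 15/64 * (y - 56/15)\<^sup>2"
        unfolding c3 c45 c6[OF 4] by (simp add: power2_eq_square field_simps)
      then show ?thesis
        using part6 c12 le zero_le_power2[of "x - 4/3"] zero_le_power2[of "y - 56/15"] by linarith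
    qed
  qed
qed

lemma tail_error_at_optimum: "tail_error 1 (7/3) 5 \<le> 1/3"
proof -
  have "tail_error 1 (7/3) 5 =
      (\<Sum>i<3. (1/2) ^ Suc i * cost 1 (7/3) 5 (Suc i)) + (1/2) ^ 3 * (2 + (real 3 + 2 - 5)\<^sup>2)"
    by (rule tail_error_eq) (subst cost_cells, auto)
  also have "\<dots> = 1/3"
    by (simp add: cost_cells eval_nat_numeral)
  finally show ?thesis by simp
qed

section \<open>Return to the original measure\<close>

theorem theorem1p3:
  fixes k n :: nat and p a :: "nat \<Rightarrow> real" and P :: "real measure"
  assumes "k \<ge> 2"
    and "bij_betw p {1..k - 1} ((\<lambda>j. 1 / 2 ^ j) ` {1..k - 1})"
    and "\<And>j. j \<ge> k \<Longrightarrow> p j = 1 / 2 ^ j"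
    and "P = dirac_series p"
    and "n \<ge> k + 2"
    and "strict_mono_on {1..n} a"
    and "optimal_means P n (a ` {1..n})"
    and "\<And>i. i \<in> {1..n - 3} \<Longrightarrow> a i = real i"
  shows "((a (n - 2) = real (n - 2) \<and> a (n - 1) = Av p (n - 1) n \<and> a n = Av_inf p (n + 1)) \<or>
          (a (n - 2) = Av p (n - 2) (n - 1) \<and> a (n - 1) = Av p n (n + 1) \<and> a n = Av_inf p (n + 2))) \<and>
         quantization_error P n = ennreal (2 powi (3 - int n) / 3)"
proof -
  define b where "b = n - 3"
  \<comment> \<open>From \<open>n \<ge> k + 2\<close> every atom beyond \<open>b\<close> has index
    at least \<open>k\<close>, outside the permuted range.\<close>
  have n: "n = b + 3" and b: "1 \<le> b" "k \<le> b + 1"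
    using assms(1,5) by (auto simp: b_def)
  have pj: "p j = 1 / 2 ^ j" if "j > b" for j
    using that b by (intro assms(3)) simp
  define x y z where "x = a (b + 1) - b" and "y = a (b + 2) - b" and "z = a (b + 3) - b"
  have a: "a (b + 1) = b + x" "a (b + 2) = b + y" "a (b + 3) = b + z"
    by (simp_all add: x_def y_def z_def)
  have ab: "a i = real i" if "i \<in> {1..b}" for i
    using assms(8) that by (simp add: b_def)
  have "a b < a (b + 1)" "a (b + 1) < a (b + 2)" "a (b + 2) < a (b + 3)"
    by (rule strict_mono_onD[OF assms(6)]; use b in \<open>simp add: n\<close>)+
  then have xyz: "0 < x" "x < y" "y < z"
    using ab[of b] b unfolding a by simp_all
  have "{1..n} = {1..b} \<union> {b + 1, b + 2, b + 3}"
    by (auto simp: n)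
  moreover have "a ` {1..b} = real ` {1..b}"
    using ab by (intro image_cong) simp_all
  ultimately have "a ` {1..n} = real ` {1..b} \<union> {b + x, b + y, b + z}"
    by (simp only: image_Un image_insert image_empty a)
  then have err: "quantization_error P n = ennreal ((1/2) ^ b * tail_error x y z)"
    using assms(7) distortion_error_eq_tail_error[OF b(1) pj, of x y z]
    by (simp add: optimal_means_def assms(4))
  \<comment> \<open>The competitor is the first optimal configuration \<open>1, 7/3, 5\<close>,
    shifted back by \<open>b\<close>.\<close>
  let ?\<beta> = "real ` {1..b} \<union> {real b + 1, real b + 7/3, real b + 5}"
  have "card ?\<beta> \<le> card (real ` {1..b}) + card {real b + 1, real b + 7/3, real b + 5}"
    by (rule card_Un_le)
  also have "\<dots> \<le> b + 3"
    by (intro add_mono order_trans[OF card_image_le]) (auto simp: card_insert_if)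
  finally have "card ?\<beta> \<le> n" by (simp add: n)
  then have "quantization_error P n \<le> distortion_error P ?\<beta>"
    unfolding quantization_error_def by (intro INF_lower) (auto simp: Suc_le_eq card_gt_0_iff)
  also have "\<dots> = ennreal ((1/2) ^ b * tail_error 1 (7/3) 5)"
    unfolding assms(4) by (rule distortion_error_eq_tail_error[OF b(1) pj])
  also have "\<dots> \<le> ennreal ((1/2) ^ b * (1/3))"
    using tail_error_at_optimum by (intro ennreal_leI mult_left_mono) simp_all
  finally have "(1/2) ^ b * tail_error x y z \<le> (1/2) ^ b * (1/3)"
    unfolding err by (subst (asm) ennreal_le_iff) simp_all
  then have "tail_error x y z \<le> 1/3" by simp
  note opt = tail_error_le_third[OF xyz this]
  have error_value: "(2::real) powi (3 - int n) / 3 = (1/2) ^ b * (1/3)"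
    by (simp add: n power_int_minus power_one_over inverse_eq_divide)
  \<comment> \<open>The optimal coordinates, shifted back by \<open>b\<close>, are the conditional
    means of their cells.\<close>
  have pairs: "Av p (b + 2) (b + 3) = b + 7/3" "Av p (b + 1) (b + 2) = b + 4/3"
    "Av p (b + 3) (b + 4) = b + 10/3"
    using Av_dyadic_pair[of "b + 2" p] Av_dyadic_pair[of "b + 1" p] Av_dyadic_pair[of "b + 3" p] pj
    by (simp_all add: eval_nat_numeral)
  have tails: "Av_inf p (b + 4) = b + 5" "Av_inf p (b + 5) = b + 6"
    using Av_inf_dyadic[of "b + 4" p] Av_inf_dyadic[of "b + 5" p] pj by simp_all
  have indices: "b + 3 - 2 = b + 1" "b + 3 - 1 = b + 2" "b + 3 + 1 = b + 4" "b + 3 + 2 = b + 5"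
    by simp_all
  show ?thesis
    unfolding error_value err unfolding n indices a pairs tails using opt by auto
qed

end
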